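(* For $n\ge 3$ let $GP(n,1)=C_n\,\square\,P_2$ be the prism graph (the Cartesian product of the cycle on $n$ vertices with the path on 2 vertices), and let $\ell$ be an integer with $0\le \ell\le 2n$. Then $$Z^+_{(\ell)}(GP(n,1)) = \begin{cases} 3 & \text{if } \ell\in\{0,1\} \text{ and } n=3,\\ 4 & \text{if } \ell\in\{0,1\} \text{ and } n\ge 4,\\ 4 & \text{if } \ell=2 \text{ and } n\in\{4,5,6\},\\ 2n & \text{if } \ell\ge 3.\end{cases}$$ (No assertion is made for $\ell=2$ with $n\notin\{4,5,6\}$.)
   Context: All graphs are finite, simple and undirected. Positive semidefinite (psd) color change rule: given the current set $B$ of blue vertices of a graph $G$, let $W_1,\dots,W_k$ be the vertex sets of the connected components of $G-B$. If $u\in B$ and $w\in W_i$ is the only non-blue neighbor of $u$ in the induced subgraph $G[W_i\cup B]$, then $u$ may force $w$ (written $u\to w$), and $w$ becomes blue. The rule is applied iteratively, with the components recomputed from the current blue set. A leak is a vertex that is not allowed to perform any force. For $0\le \ell\le |V(G)|$, a set $B\subseteq V(G)$ is an $\ell$-leaky positive semidefinite forcing set of $G$ if, for every choice of $\ell$ vertices as leaks (chosen after $B$ is fixed; leaks may be inside or outside $B$), starting with exactly $B$ blue, iterated application of the psd color change rule, with forces performed only by non-leak vertices, colors all of $V(G)$ blue. The $\ell$-leaky positive semidefinite forcing number $Z^+_{(\ell)}(G)$ is the minimum cardinality of an $\ell$-leaky positive semidefinite forcing set of $G$. *)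

theory Defs
  imports Graph_Theory.Graph_Theory
begin

text \<open>
  Finite simple undirected graphs are the symmetric, loop-free digraphs without parallel arcs
  of the locale \<^locale>\<open>graph\<close>. For these the strongly connected components are the connected
  components.
\<close>

definition psd_force :: "('a, 'b) pre_digraph \<Rightarrow> 'a set \<Rightarrow> 'a \<Rightarrow> 'a \<Rightarrow> bool" where
  "psd_force G B u w \<longleftrightarrow> u \<in> B \<and>
     (\<exists>W \<in> pre_digraph.sccs_verts (G \<restriction> (verts G - B)).
        w \<in> W \<and> {x. u \<rightarrow>\<^bsub>G \<restriction> (W \<union> B)\<^esub> x \<and> x \<notin> B} = {w})"

text \<open>
  A step performs one force by a non-leak vertex; the components in \<^const>\<open>psd_force\<close> are those
  left by the blue set current at that step.
\<close>
inductive leaky_psd_step :: "('a, 'b) pre_digraph \<Rightarrow> 'a set \<Rightarrow> 'a set \<Rightarrow> 'a set \<Rightarrow> bool"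
  for G :: "('a, 'b) pre_digraph" and L :: "'a set" where
  "psd_force G B u w \<Longrightarrow> u \<notin> L \<Longrightarrow> leaky_psd_step G L B (insert w B)"

definition leaky_psd_forcing_set :: "('a, 'b) pre_digraph \<Rightarrow> nat \<Rightarrow> 'a set \<Rightarrow> bool" where
  "leaky_psd_forcing_set G l B \<longleftrightarrow> B \<subseteq> verts G \<and>
     (\<forall>L. L \<subseteq> verts G \<and> card L = l \<longrightarrow> (leaky_psd_step G L)\<^sup>*\<^sup>* B (verts G))"

definition leaky_psd_forcing_number :: "('a, 'b) pre_digraph \<Rightarrow> nat \<Rightarrow> nat" where
  "leaky_psd_forcing_number G l = Min (card ` {B. leaky_psd_forcing_set G l B})"

lemma finite_leaky_psd_forcing_sets:
  "finite (verts G) \<Longrightarrow> finite {B. leaky_psd_forcing_set G l B}"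
  by (rule finite_subset[of _ "Pow (verts G)"]) (auto simp: leaky_psd_forcing_set_def)

lemma leaky_psd_forcing_set_verts: "leaky_psd_forcing_set G l (verts G)"
  by (auto simp: leaky_psd_forcing_set_def)

definition cycle_graph :: "nat \<Rightarrow> nat pair_pre_digraph" where
  "cycle_graph n = \<lparr> pverts = {..<n},
     parcs = {(i, j). i < n \<and> j < n \<and> (j = Suc i mod n \<or> i = Suc j mod n)} \<rparr>"

definition path_graph :: "nat \<Rightarrow> nat pair_pre_digraph" where
  "path_graph n = \<lparr> pverts = {..<n},
     parcs = {(i, j). i < n \<and> j < n \<and> (j = Suc i \<or> i = Suc j)} \<rparr>"

definition cartesian_product ::
  "'a pair_pre_digraph \<Rightarrow> 'b pair_pre_digraph \<Rightarrow> ('a \<times> 'b) pair_pre_digraph" where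
  "cartesian_product G H = \<lparr> pverts = pverts G \<times> pverts H,
     parcs = {((a, b), (c, d)). (a = c \<and> a \<in> pverts G \<and> (b, d) \<in> parcs H) \<or>
                                (b = d \<and> b \<in> pverts H \<and> (a, c) \<in> parcs G)} \<rparr>"

definition prism_graph :: "nat \<Rightarrow> (nat \<times> nat) pair_pre_digraph" where
  "prism_graph n = cartesian_product (cycle_graph n) (path_graph 2)"

lemma pair_graphI:
  assumes "finite (pverts G)" "parcs G \<subseteq> pverts G \<times> pverts G" "sym (parcs G)" "irrefl (parcs G)"
  shows "pair_graph G"
proof -
  have "finite (parcs G)"
    using assms(1,2) by (meson finite_SigmaI finite_subset)
  moreover have "\<And>e. e \<in> parcs G \<Longrightarrow> fst e \<noteq> snd e"
    using assms(4) by (auto simp: irrefl_def)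
  ultimately show ?thesis
    using assms by unfold_locales (auto simp: symmetric_def)
qed

lemma pair_graph_cycle_graph:
  assumes "n \<ge> 2"
  shows "pair_graph (cycle_graph n)"
proof (rule pair_graphI)
  have "Suc i mod n \<noteq> i" if "i < n" for i
    using that assms by (cases "Suc i = n") auto
  then have "i \<noteq> Suc i mod n" if "i < n" for i
    using that by metis
  then show "irrefl (parcs (cycle_graph n))"
    by (auto simp: cycle_graph_def irrefl_def)
qed (auto simp: cycle_graph_def sym_def)

lemma pair_graph_path_graph: "pair_graph (path_graph n)"
  by (rule pair_graphI) (auto simp: path_graph_def sym_def irrefl_def)

lemma pair_graph_cartesian_product:
  assumes "pair_graph G" "pair_graph H"
  shows "pair_graph (cartesian_product G H)"
proof -
  interpret G: pair_graph G by fact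
  interpret H: pair_graph H by fact
  have symG: "sym (parcs G)" and symH: "sym (parcs H)"
    using G.pair_sym_arcs H.pair_sym_arcs by (auto simp: symmetric_def)
  show ?thesis
  proof (rule pair_graphI)
    show "sym (parcs (cartesian_product G H))"
      using symG symH by (auto simp: cartesian_product_def sym_def)
    show "irrefl (parcs (cartesian_product G H))"
      using G.pair_no_loops H.pair_no_loops by (force simp: cartesian_product_def irrefl_def)
  qed (auto simp: cartesian_product_def dest: G.in_arcsD1 G.in_arcsD2 H.in_arcsD1 H.in_arcsD2)
qed

lemma pair_graph_prism_graph: "n \<ge> 2 \<Longrightarrow> pair_graph (prism_graph n)"
  unfolding prism_graph_def
  by (intro pair_graph_cartesian_product pair_graph_cycle_graph pair_graph_path_graph)

end

(*
  With at least three leaks, a white vertex whose (at most three) neighbours all leak is never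
  forced, so only the full vertex set works.

  Lower bounds: if u forces w, then every other neighbour of u is blue or separated from w by the
  blue set. After u is deleted, two neighbours of u are still joined by two disjoint paths, each of
  which must be blocked. Hence a force needs at least three blue vertices, and for n >= 4 a set of
  at most three blue vertices which performs a force stays inside the closed neighbourhood of some
  vertex. From a full closed neighbourhood no force is possible, so the process never gets further.

  Upper bounds: it suffices that every proper blue superset of the starting set has more possible
  forcing vertices than there are leaks. Two adjacent columns (or one row, for n = 3) give two
  forcing vertices. For two leaks, columns 0 and 3 leave gaps of width at most two. Each white
  vertex of a gap is forced by its own outer neighbour, so when both leaks stop this at most two
  white vertices remain in the gap, and in a cubic triangle-free graph these have three possible
  forcing vertices.
*)

theory Submission
  imports Defs
begin

section \<open>Forces and forcing sets of graphs\<close>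

lemma adj_induce_subgraph_iff:
  "u \<rightarrow>\<^bsub>G \<restriction> S\<^esub> v \<longleftrightarrow> u \<rightarrow>\<^bsub>G\<^esub> v \<and> u \<in> S \<and> v \<in> S"
  by (auto simp: arcs_ends_conv)

lemma leaky_psd_step_antimono:
  "leaky_psd_step G L B C \<Longrightarrow> K \<subseteq> L \<Longrightarrow> leaky_psd_step G K B C"
  by (auto simp: leaky_psd_step.simps)

text \<open>A set of \<open>l\<close> leaks extends to a set of \<open>k\<close> leaks, and a run
  that avoids the larger set also avoids the smaller one. The bound on \<open>k\<close> leaves room
  for the extension.\<close>

lemma leaky_psd_forcing_set_antimono:
  assumes fin: "finite (verts G)"
    and B: "leaky_psd_forcing_set G k B" and le: "l \<le> k" "k \<le> card (verts G)"
  shows "leaky_psd_forcing_set G l B"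
  unfolding leaky_psd_forcing_set_def
proof (intro conjI allI impI)
  show "B \<subseteq> verts G"
    using B by (simp add: leaky_psd_forcing_set_def)
  fix L assume L: "L \<subseteq> verts G \<and> card L = l"
  then obtain K where K: "L \<subseteq> K" "K \<subseteq> verts G" "card K = k"
    using exists_subset_between[of L k "verts G"] fin le by auto
  then have "(leaky_psd_step G K)\<^sup>*\<^sup>* B (verts G)"
    using B by (simp add: leaky_psd_forcing_set_def)
  then show "(leaky_psd_step G L)\<^sup>*\<^sup>* B (verts G)"
    using mono_rtranclp leaky_psd_step_antimono[OF _ K(1)] by metis
qed

context graph
begin

lemma psd_forceD:
  assumes "psd_force G B u w"
  shows "u \<in> B" "w \<notin> B" "u \<rightarrow>\<^bsub>G\<^esub> w"
  using assms by (auto simp: psd_force_def adj_induce_subgraph_iff)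

text \<open>This is the form in which the lower bounds use a force: any white neighbour of
  \<open>u\<close> other than \<open>w\<close> must lie in a different component. Since the graph is
  symmetric, reachability in one direction already puts \<open>y\<close> into the component of
  \<open>w\<close>.\<close>

lemma psd_force_reachable_eq:
  assumes F: "psd_force G B u w" and y: "u \<rightarrow>\<^bsub>G\<^esub> y" "w \<rightarrow>\<^sup>*\<^bsub>G \<restriction> (verts G - B)\<^esub> y"
  shows "y = w"
proof -
  let ?H = "G \<restriction> (verts G - B)"
  have sym: "symmetric ?H"
    using sym_arcs by (rule induced_graph_imp_symmetric) (auto simp: Diff_subset)
  obtain W where W: "W \<in> pre_digraph.sccs_verts ?H" "w \<in> W"
    and eq: "{x. u \<rightarrow>\<^bsub>G \<restriction> (W \<union> B)\<^esub> x \<and> x \<notin> B} = {w}"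
    using F by (auto simp: psd_force_def)
  have "y \<in> W"
    using W y(2) symmetric_reachable[OF sym y(2)] by (auto simp: pre_digraph.sccs_verts_def)
  moreover have "y \<notin> B"
    using wf_digraph.reachable_in_verts(2)[OF wellformed_induce_subgraph y(2)] by simp
  ultimately show ?thesis
    using eq y psd_forceD[OF F] by (auto simp: adj_induce_subgraph_iff)
qed

text \<open>\<open>W\<close> need not be a component. Closure under white neighbours makes it
  contain the component of \<open>w\<close>, and uniqueness inside \<open>W\<close> passes down to
  that component. Forces can thus be exhibited without computing components.\<close>

lemma psd_forceI:
  assumes u: "u \<in> B" "u \<rightarrow>\<^bsub>G\<^esub> w" and w: "w \<in> W" "w \<notin> B"
    and closed: "\<And>x y. x \<in> W \<Longrightarrow> x \<rightarrow>\<^bsub>G\<^esub> y \<Longrightarrow> y \<notin> B \<Longrightarrow> y \<in> W"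
    and uniq: "\<And>x. x \<in> W \<Longrightarrow> u \<rightarrow>\<^bsub>G\<^esub> x \<Longrightarrow> x = w"
  shows "psd_force G B u w"
proof -
  let ?H = "G \<restriction> (verts G - B)"
  interpret H: wf_digraph ?H by (rule wellformed_induce_subgraph)
  have wH: "w \<in> verts ?H"
    using u w adj_in_verts by auto
  have reach: "y \<in> W" if "w \<rightarrow>\<^sup>*\<^bsub>?H\<^esub> y" for y
    using that
  proof (induction rule: H.reachable_induct)
    case (step x y)
    then show ?case using closed[of x y] H.adj_in_verts[OF step(2)]
      by (simp add: adj_induce_subgraph_iff)
  qed (use w in simp)
  have w_scc: "w \<in> H.scc_of w"
    using wH by (rule H.in_scc_of_self)
  have "H.scc_of w \<subseteq> W"
    unfolding H.scc_of_def using reach by blast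
  then have "{x. u \<rightarrow>\<^bsub>G \<restriction> (H.scc_of w \<union> B)\<^esub> x \<and> x \<notin> B} = {w}"
    unfolding adj_induce_subgraph_iff using u w(2) uniq w_scc by blast
  then show ?thesis
    unfolding psd_force_def
    using u(1) H.scc_of_in_sccs_verts[OF wH] w_scc by blast
qed

lemma leaky_psd_step_subset_verts:
  "leaky_psd_step G L B C \<Longrightarrow> B \<subseteq> verts G \<Longrightarrow> C \<subseteq> verts G"
  by (auto simp: leaky_psd_step.simps dest: psd_forceD adj_in_verts)

text \<open>Because a force is available from every proper blue superset, any choice of next force
  will do, and induction on the number of white vertices finishes.\<close>

lemma leaky_psd_forcing_setI:
  assumes "B \<subseteq> verts G"
    and force: "\<And>L C. L \<subseteq> verts G \<Longrightarrow> card L = l \<Longrightarrow> B \<subseteq> C \<Longrightarrow> C \<subset> verts G \<Longrightarrow>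
      \<exists>u w. u \<notin> L \<and> psd_force G C u w"
  shows "leaky_psd_forcing_set G l B"
  unfolding leaky_psd_forcing_set_def
proof (intro conjI allI impI)
  show "B \<subseteq> verts G" by fact
  fix L assume L: "L \<subseteq> verts G \<and> card L = l"
  have "(leaky_psd_step G L)\<^sup>*\<^sup>* C (verts G)" if "B \<subseteq> C" "C \<subseteq> verts G" for C
    using that
  proof (induction "card (verts G - C)" arbitrary: C rule: less_induct)
    case less
    show ?case
    proof (cases "C = verts G")
      case False
      then obtain u w where uw: "u \<notin> L" "psd_force G C u w"
        using force[of L C] L less.prems by auto
      then have step: "leaky_psd_step G L C (insert w C)"
        by (auto intro: leaky_psd_step.intros)
      have w: "w \<in> verts G" "w \<notin> C"
        using psd_forceD[OF uw(2)] adj_in_verts by auto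
      have "card (verts G - insert w C) < card (verts G - C)"
        using w by (intro psubset_card_mono) auto
      then have "(leaky_psd_step G L)\<^sup>*\<^sup>* (insert w C) (verts G)"
        using less.hyps[of "insert w C"] less.prems w by auto
      with step show ?thesis by (rule converse_rtranclp_into_rtranclp)
    qed simp
  qed
  then show "(leaky_psd_step G L)\<^sup>*\<^sup>* B (verts G)"
    using \<open>B \<subseteq> verts G\<close> by simp
qed

text \<open>The tool for lower bounds. Passing to zero leaks first makes the invariant independent
  of the leak set; it is then carried along a run to the full vertex set, where a small-size
  invariant is absurd.\<close>

lemma leaky_psd_forcing_set_invariant:
  assumes "leaky_psd_forcing_set G l B" "l \<le> card (verts G)" "P B"
    and step: "\<And>C u w. C \<subseteq> verts G \<Longrightarrow> P C \<Longrightarrow> psd_force G C u w \<Longrightarrow> P (insert w C)"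
  shows "P (verts G)"
proof -
  have B: "leaky_psd_forcing_set G 0 B"
    using leaky_psd_forcing_set_antimono[OF _ assms(1)] assms(2) by simp
  then have "(leaky_psd_step G {})\<^sup>*\<^sup>* B (verts G)"
    by (simp add: leaky_psd_forcing_set_def)
  moreover have "P C \<and> C \<subseteq> verts G" if "(leaky_psd_step G {})\<^sup>*\<^sup>* B C" for C
    using that
  proof (induction rule: rtranclp_induct)
    case base
    then show ?case using B \<open>P B\<close> by (simp add: leaky_psd_forcing_set_def)
  next
    case (step C D)
    then show ?case
      using assms(4) leaky_psd_step_subset_verts[OF step(2)]
      by (auto simp: leaky_psd_step.simps)
  qed
  ultimately show ?thesis by blast
qed

lemma leaky_psd_forcing_set_eq_verts:
  assumes B: "leaky_psd_forcing_set G l B" and l: "l \<le> card (verts G)"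
    and deg: "\<And>v. v \<in> verts G \<Longrightarrow> card {u. u \<rightarrow>\<^bsub>G\<^esub> v} \<le> l"
  shows "B = verts G"
proof (rule ccontr)
  assume "B \<noteq> verts G"
  then obtain v where v: "v \<in> verts G" "v \<notin> B"
    using B by (auto simp: leaky_psd_forcing_set_def)
  obtain L where L: "{u. u \<rightarrow>\<^bsub>G\<^esub> v} \<subseteq> L" "L \<subseteq> verts G" "card L = l"
    using exists_subset_between[of "{u. u \<rightarrow>\<^bsub>G\<^esub> v}" l "verts G"] l deg v adj_in_verts by auto
  then have "(leaky_psd_step G L)\<^sup>*\<^sup>* B (verts G)"
    using B by (simp add: leaky_psd_forcing_set_def)
  \<comment> \<open>Induction along the run: \<open>v\<close> stays white, since every vertex that
    could force it is in \<open>L\<close>.\<close>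
  then have "v \<notin> verts G"
    by (induction rule: rtranclp_induct)
      (use v L in \<open>auto simp: leaky_psd_step.simps dest: psd_forceD\<close>)
  then show False using v by simp
qed

lemma leaky_psd_forcing_number_eqI:
  assumes "leaky_psd_forcing_set G l B" "card B = k"
    and "\<And>C. leaky_psd_forcing_set G l C \<Longrightarrow> k \<le> card C"
  shows "leaky_psd_forcing_number G l = k"
  unfolding leaky_psd_forcing_number_def
  using assms finite_leaky_psd_forcing_sets[of G l] by (intro Min_eqI) auto

end

lemma (in graph) adj_sym: "x \<rightarrow>\<^bsub>G\<^esub> y \<Longrightarrow> y \<rightarrow>\<^bsub>G\<^esub> x"
  using sym_arcs by (auto simp: symmetric_def dest: symD)

section \<open>Counting possible forcers against leaks\<close>

lemma exists_force_two_forcers: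
  assumes "card L = 1" "psd_force G C u w" "psd_force G C u' w'" "u \<noteq> u'"
  shows "\<exists>u w. u \<notin> L \<and> psd_force G C u w"
proof -
  obtain x where "L = {x}" using assms(1) by (rule card_1_singletonE)
  then have "u \<notin> L \<or> u' \<notin> L" using assms(4) by auto
  then show ?thesis using assms(2,3) by blast
qed

text \<open>At least three vertices can force, so two leaks cannot stop all of them. If
  \<open>W\<close> has no edge, any \<open>x\<close> in \<open>W\<close> is a white component by
  itself and all its neighbours can force it. If \<open>W\<close> is an edge, each end has two
  further neighbours, all blue; without triangles these two pairs are disjoint and each of the four
  vertices sees only one end.\<close>

lemma (in graph) exists_force_small_component:
  assumes W: "W \<subseteq> verts G" "W \<inter> C = {}" "W \<noteq> {}" "card W \<le> 2"
    and closed: "\<And>x y. x \<in> W \<Longrightarrow> x \<rightarrow>\<^bsub>G\<^esub> y \<Longrightarrow> y \<notin> C \<Longrightarrow> y \<in> W"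
    and deg: "\<And>x. x \<in> W \<Longrightarrow> 3 \<le> card {y. x \<rightarrow>\<^bsub>G\<^esub> y}"
    and triangle_free: "\<And>x y z. x \<rightarrow>\<^bsub>G\<^esub> y \<Longrightarrow> y \<rightarrow>\<^bsub>G\<^esub> z \<Longrightarrow> \<not> z \<rightarrow>\<^bsub>G\<^esub> x"
    and L: "finite L" "card L \<le> 2"
  shows "\<exists>u w. u \<notin> L \<and> psd_force G C u w"
proof -
  have "\<exists>F. (\<forall>u\<in>F. \<exists>w. psd_force G C u w) \<and> 3 \<le> card F"
  proof (cases "\<exists>x\<in>W. \<exists>y\<in>W. x \<rightarrow>\<^bsub>G\<^esub> y")
    case False
    obtain x where x: "x \<in> W" using W by auto
    have "psd_force G C u x" if "x \<rightarrow>\<^bsub>G\<^esub> u" for u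
    proof (rule psd_forceI[where W = "{x}"])
      show "u \<in> C" "x \<notin> C" using that closed[OF x] False x W by auto
      show "u \<rightarrow>\<^bsub>G\<^esub> x" using that by (rule adj_sym)
      show "y \<in> {x}" if "z \<in> {x}" "z \<rightarrow>\<^bsub>G\<^esub> y" "y \<notin> C" for z y
        using that closed[OF x, of y] False x by blast
    qed auto
    then show ?thesis
      using deg[OF x] by (intro exI[of _ "{y. x \<rightarrow>\<^bsub>G\<^esub> y}"]) auto
  next
    case True
    then obtain x y where xy: "x \<in> W" "y \<in> W" "x \<rightarrow>\<^bsub>G\<^esub> y" by auto
    then have "x \<noteq> y" using adj_not_same by auto
    then have W_eq: "W = {x, y}"
      using card_seteq[of W "{x, y}"] xy W finite_subset[OF W(1)] by auto
    have forces: "psd_force G C u p" if pq: "W = {p, q}" "p \<rightarrow>\<^bsub>G\<^esub> q" "p \<rightarrow>\<^bsub>G\<^esub> u" "u \<noteq> q" for p q u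
    proof (rule psd_forceI[where W = W])
      have "u \<notin> W" using pq adj_not_same by auto
      then show "u \<in> C" using closed[of p u] pq by auto
      show "u \<rightarrow>\<^bsub>G\<^esub> p" using pq(3) by (rule adj_sym)
      show "p \<in> W" "p \<notin> C" using pq W by auto
      \<comment> \<open>If \<open>u\<close> also saw \<open>q\<close>, then \<open>p\<close>,
        \<open>u\<close>, \<open>q\<close> would be a triangle.\<close>
      show "z = p" if "z \<in> W" "u \<rightarrow>\<^bsub>G\<^esub> z" for z
        using that pq triangle_free[of p u q] adj_sym[of p q] by auto
    qed (rule closed)
    let ?F = "\<lambda>p q. {u. p \<rightarrow>\<^bsub>G\<^esub> u} - {q}"
    have fin: "finite {u. p \<rightarrow>\<^bsub>G\<^esub> u}" for p
      by (rule finite_subset[of _ "verts G"]) (auto dest: adj_in_verts)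
    have "2 \<le> card (?F x y)" "2 \<le> card (?F y x)"
      using deg[OF xy(1)] deg[OF xy(2)] fin adj_sym[OF xy(3)] xy(3)
      by (simp_all add: card_Diff_singleton)
    moreover have "?F x y \<inter> ?F y x = {}"
      using triangle_free[of x y] xy(3) adj_sym by blast
    ultimately have "3 \<le> card (?F x y \<union> ?F y x)"
      using fin by (subst card_Un_disjoint) auto
    moreover have "\<exists>w. psd_force G C u w" if "u \<in> ?F x y \<union> ?F y x" for u
      using that forces[of x y u] forces[of y x u] W_eq adj_sym[OF xy(3)] xy(3) by blast
    ultimately show ?thesis by blast
  qed
  then obtain F where F: "\<forall>u\<in>F. \<exists>w. psd_force G C u w" "3 \<le> card F" by auto
  then have "\<not> F \<subseteq> L" using card_mono[of L F] L by auto
  then show ?thesis using F(1) by blast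
qed

lemma (in wf_digraph) reachable_row:
  fixes f :: "int \<Rightarrow> 'a"
  assumes "i \<le> j" "\<And>k. i \<le> k \<Longrightarrow> k < j \<Longrightarrow> f k \<rightarrow>\<^bsub>G\<^esub> f (k + 1)"
    and "\<And>k. i \<le> k \<Longrightarrow> k \<le> j \<Longrightarrow> f k \<in> verts G"
  shows "f i \<rightarrow>\<^sup>*\<^bsub>G\<^esub> f j"
  using assms
proof (induction j rule: int_ge_induct)
  case base
  then show ?case by (simp add: reachable_refl)
next
  case (step j)
  then have "f i \<rightarrow>\<^sup>*\<^bsub>G\<^esub> f j" "f j \<rightarrow>\<^bsub>G\<^esub> f (j + 1)" by auto
  then show ?case by (rule reachable_adj_trans)
qed

section \<open>Prisms\<close>

text \<open>
  The column index is an integer, read modulo \<open>n\<close>, so that columns can be shifted and reflected;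
  by these symmetries it suffices to study forces performed by the vertex \<open>v 0 True\<close>.
\<close>

locale prism = graph G for G :: "('a, 'b) pre_digraph" +
  fixes n :: nat and v :: "int \<Rightarrow> bool \<Rightarrow> 'a"
  assumes n_ge_3: "3 \<le> n"
    and verts_eq: "verts G = {v i b |i b. True}"
    and v_eq_iff: "v i b = v j c \<longleftrightarrow> int n dvd i - j \<and> b = c"
    and adj_iff: "v i b \<rightarrow>\<^bsub>G\<^esub> y \<longleftrightarrow> y = v (i + 1) b \<or> y = v (i - 1) b \<or> y = v i (\<not> b)"
begin

lemma v_in_verts [simp]: "v i b \<in> verts G"
  by (auto simp: verts_eq)

lemma v_eq: "i - j < int n \<Longrightarrow> j - i < int n \<Longrightarrow> v i b = v j c \<longleftrightarrow> i = j \<and> b = c"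
  using dvd_imp_le_int[of "i - j" "int n"] by (cases "i = j") (auto simp: v_eq_iff)

lemma v_rows_neq [simp]: "v i True \<noteq> v j False" "v i False \<noteq> v j True"
  by (simp_all add: v_eq_iff)

lemma v_periodic: "v (int n + i) b = v i b"
  by (simp add: v_eq_iff)

lemma prism_reflect: "prism G n (\<lambda>i. v (- i))"
proof
  show "verts G = {v (- i) b |i b. True}"
    unfolding verts_eq by (metis minus_minus)
  show "v (- i) b = v (- j) c \<longleftrightarrow> int n dvd i - j \<and> b = c" for i b j c
    by (simp add: v_eq_iff dvd_diff_commute)
  have "- (i + 1) = - i - 1" "- (i - 1) = - i + 1" for i :: int by auto
  then show "v (- i) b \<rightarrow>\<^bsub>G\<^esub> y \<longleftrightarrow>
      y = v (- (i + 1)) b \<or> y = v (- (i - 1)) b \<or> y = v (- i) (\<not> b)" for i b y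
    by (auto simp only: adj_iff)
qed (rule n_ge_3)

text \<open>For \<open>a = False\<close> the map \<open>b = a\<close> is negation and swaps the
  rows; for \<open>a = True\<close> it is the identity. In the new coordinates \<open>v m a\<close>
  plays the part of \<open>v 0 True\<close>.\<close>

lemma prism_shift: "prism G n (\<lambda>i b. v (m + i) (b = a))"
proof
  have "v i b = v (m + (i - m)) ((b = a) = a)" for i b
    by (cases a; cases b) simp_all
  then show "verts G = {v (m + i) (b = a) |i b. True}"
    unfolding verts_eq by blast
  show "v (m + i) (b = a) = v (m + j) (c = a) \<longleftrightarrow> int n dvd i - j \<and> b = c" for i b j c
    by (auto simp: v_eq_iff)
  show "v (m + i) (b = a) \<rightarrow>\<^bsub>G\<^esub> y \<longleftrightarrow>
      y = v (m + (i + 1)) (b = a) \<or> y = v (m + (i - 1)) (b = a) \<or> y = v (m + i) ((\<not> b) = a)" for i b y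
    by (cases a; cases b) (auto simp: adj_iff algebra_simps)
qed (rule n_ge_3)

section \<open>Blue sets separating two neighbours of a vertex\<close>

lemma reachable_row_minus:
  assumes "i \<le> j" "\<And>k. i \<le> k \<Longrightarrow> k \<le> j \<Longrightarrow> v k b \<notin> B"
  shows "v i b \<rightarrow>\<^sup>*\<^bsub>G \<restriction> (verts G - B)\<^esub> v j b"
  using assms
  by (intro wf_digraph.reachable_row[OF wellformed_induce_subgraph])
    (auto simp: adj_induce_subgraph_iff adj_iff)

lemma reachable_rung_minus:
  assumes "v i b \<notin> B" "v i (\<not> b) \<notin> B"
  shows "v i b \<rightarrow>\<^sup>*\<^bsub>G \<restriction> (verts G - B)\<^esub> v i (\<not> b)"
  using assms
  by (intro wf_digraph.reachable_adjI[OF wellformed_induce_subgraph])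
    (auto simp: adj_induce_subgraph_iff adj_iff)

lemmas reachable_minus_trans = wf_digraph.reachable_trans[OF wellformed_induce_subgraph]

lemma reachable_minus_sym:
  assumes "x \<rightarrow>\<^sup>*\<^bsub>G \<restriction> (verts G - B)\<^esub> y"
  shows "y \<rightarrow>\<^sup>*\<^bsub>G \<restriction> (verts G - B)\<^esub> x"
proof (rule symmetric_reachable[OF _ assms])
  show "symmetric (G \<restriction> (verts G - B))"
    using sym_arcs by (rule induced_graph_imp_symmetric) auto
qed

text \<open>Two paths avoiding \<open>v 0 True\<close> join its neighbours \<open>v 1 True\<close>
  and \<open>v 0 False\<close>: a short one through \<open>v 1 False\<close>, and a long one through
  \<open>v 2 True\<close>, down that rung and along the other row around the cycle. They share only
  their ends, so each must contain its own blue vertex.\<close>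

lemma corner_separated:
  assumes B: "v 0 False \<notin> B" "v 1 True \<notin> B"
    and sep: "\<not> v 1 True \<rightarrow>\<^sup>*\<^bsub>G \<restriction> (verts G - B)\<^esub> v 0 False"
  shows "v 1 False \<in> B" "v 2 True \<in> B \<or> (\<exists>k. 2 \<le> k \<and> k < int n \<and> v k False \<in> B)"
proof -
  show "v 1 False \<in> B"
  proof (rule ccontr)
    assume *: "v 1 False \<notin> B"
    have "v 1 True \<rightarrow>\<^sup>*\<^bsub>G \<restriction> (verts G - B)\<^esub> v 1 False"
      using reachable_rung_minus[of 1 True] B * by simp
    moreover have "v 0 False \<rightarrow>\<^sup>*\<^bsub>G \<restriction> (verts G - B)\<^esub> v 1 False"
    proof (rule reachable_row_minus)
      fix k :: int assume "0 \<le> k" "k \<le> 1"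
      then have "k = 0 \<or> k = 1" by auto
      then show "v k False \<notin> B" using B * by auto
    qed simp
    ultimately show False
      using sep reachable_minus_trans reachable_minus_sym by blast
  qed
  show "v 2 True \<in> B \<or> (\<exists>k. 2 \<le> k \<and> k < int n \<and> v k False \<in> B)"
  proof (rule ccontr)
    assume *: "\<not> ?thesis"
    then have v2: "v 2 True \<notin> B" "v 2 False \<notin> B"
      using n_ge_3 by auto
    have "v 1 True \<rightarrow>\<^sup>*\<^bsub>G \<restriction> (verts G - B)\<^esub> v 2 True"
    proof (rule reachable_row_minus)
      fix k :: int assume "1 \<le> k" "k \<le> 2"
      then have "k = 1 \<or> k = 2" by auto
      then show "v k True \<notin> B" using B v2 by auto
    qed simp
    moreover have "v 2 True \<rightarrow>\<^sup>*\<^bsub>G \<restriction> (verts G - B)\<^esub> v 2 False"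
      using reachable_rung_minus[of 2 True] v2 by simp
    \<comment> \<open>Column \<open>int n\<close> is column 0, so this path ends at
      \<open>v 0 False\<close>.\<close>
    moreover have "v 2 False \<rightarrow>\<^sup>*\<^bsub>G \<restriction> (verts G - B)\<^esub> v (int n) False"
    proof (rule reachable_row_minus)
      fix k assume "2 \<le> k" "k \<le> int n"
      then show "v k False \<notin> B"
        using * B(1) v_periodic[of 0] by (cases "k = int n") auto
    qed (use n_ge_3 in simp)
    ultimately show False
      using sep reachable_minus_trans v_periodic[of 0] by (metis add_0_right)
  qed
qed

text \<open>The neighbours \<open>v 1 True\<close> and \<open>v (-1) True\<close> of
  \<open>v 0 True\<close> are joined along their own row the other way around the cycle, and also by
  stepping down to the opposite row, walking along columns 1 to \<open>n - 1\<close> and stepping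
  up. Each of the two paths must be blocked.\<close>

lemma row_separated:
  assumes B: "v 1 True \<notin> B" "v (-1) True \<notin> B"
    and sep: "\<not> v 1 True \<rightarrow>\<^sup>*\<^bsub>G \<restriction> (verts G - B)\<^esub> v (-1) True"
  shows "\<exists>k. 2 \<le> k \<and> k < int n - 1 \<and> v k True \<in> B"
    and "\<exists>k. 1 \<le> k \<and> k < int n \<and> v k False \<in> B"
proof -
  have last: "v (int n - 1) b = v (-1) b" for b
    using v_periodic[of "-1"] by simp
  show "\<exists>k. 2 \<le> k \<and> k < int n - 1 \<and> v k True \<in> B"
  proof (rule ccontr)
    assume *: "\<not> ?thesis"
    have "v 1 True \<rightarrow>\<^sup>*\<^bsub>G \<restriction> (verts G - B)\<^esub> v (int n - 1) True"
    proof (rule reachable_row_minus)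
      fix k assume "1 \<le> k" "k \<le> int n - 1"
      then have "k = 1 \<or> k = int n - 1 \<or> 2 \<le> k \<and> k < int n - 1" by auto
      then show "v k True \<notin> B"
        using * B last by auto
    qed (use n_ge_3 in simp)
    then show False using sep last by simp
  qed
  show "\<exists>k. 1 \<le> k \<and> k < int n \<and> v k False \<in> B"
  proof (rule ccontr)
    assume *: "\<not> ?thesis"
    have "v 1 True \<rightarrow>\<^sup>*\<^bsub>G \<restriction> (verts G - B)\<^esub> v 1 False"
      using reachable_rung_minus[of 1 True] B * n_ge_3 by simp
    moreover have "v 1 False \<rightarrow>\<^sup>*\<^bsub>G \<restriction> (verts G - B)\<^esub> v (int n - 1) False"
      using * n_ge_3 by (intro reachable_row_minus) auto
    moreover have "v (int n - 1) False \<rightarrow>\<^sup>*\<^bsub>G \<restriction> (verts G - B)\<^esub> v (int n - 1) True"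
    proof -
      have "v (int n - 1) False \<notin> B" using * n_ge_3 by auto
      then show ?thesis
        using reachable_rung_minus[of "int n - 1" False B] B(2) last[of True] by simp
    qed
    ultimately show False
      using sep last reachable_minus_trans by metis
  qed
qed

lemma psd_force_separates:
  assumes "psd_force G B u w" "u \<rightarrow>\<^bsub>G\<^esub> y" "y \<noteq> w"
  shows "\<not> w \<rightarrow>\<^sup>*\<^bsub>G \<restriction> (verts G - B)\<^esub> y" "\<not> y \<rightarrow>\<^sup>*\<^bsub>G \<restriction> (verts G - B)\<^esub> w"
  using assms psd_force_reachable_eq reachable_minus_sym by blast+

section \<open>Every force needs three blue vertices\<close>

lemma card_ge_3I: "finite B \<Longrightarrow> {x, y, z} \<subseteq> B \<Longrightarrow> x \<noteq> y \<Longrightarrow> x \<noteq> z \<Longrightarrow> y \<noteq> z \<Longrightarrow> 3 \<le> card B"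
  using card_mono[of B "{x, y, z}"] by simp

lemma eq_triple_if_card_le_3:
  "finite B \<Longrightarrow> card B \<le> 3 \<Longrightarrow> {x, y, z} \<subseteq> B \<Longrightarrow> x \<noteq> y \<Longrightarrow> x \<noteq> z \<Longrightarrow> y \<noteq> z \<Longrightarrow> B = {x, y, z}"
  using card_seteq[of B "{x, y, z}"] by simp

lemma corner_separated_card:
  assumes "v 0 True \<in> B" "v 0 False \<notin> B" "v 1 True \<notin> B" "finite B"
    and "\<not> v 1 True \<rightarrow>\<^sup>*\<^bsub>G \<restriction> (verts G - B)\<^esub> v 0 False"
  shows "3 \<le> card B"
proof -
  from corner_separated[of B] assms have B: "v 1 False \<in> B"
    and "v 2 True \<in> B \<or> (\<exists>k. 2 \<le> k \<and> k < int n \<and> v k False \<in> B)" by auto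
  then show ?thesis
  proof (elim disjE exE conjE)
    assume "v 2 True \<in> B"
    then show ?thesis
      using B assms n_ge_3 by (intro card_ge_3I[of B "v 0 True" "v 1 False" "v 2 True"]) (auto simp: v_eq)
  next
    fix k assume "2 \<le> k" "k < int n" "v k False \<in> B"
    then show ?thesis
      using B assms n_ge_3 by (intro card_ge_3I[of B "v 0 True" "v 1 False" "v k False"]) (auto simp: v_eq)
  qed
qed

lemma row_separated_card:
  assumes "v 0 True \<in> B" "v 1 True \<notin> B" "v (-1) True \<notin> B" "finite B"
    and "\<not> v 1 True \<rightarrow>\<^sup>*\<^bsub>G \<restriction> (verts G - B)\<^esub> v (-1) True"
  shows "3 \<le> card B"
proof -
  from row_separated[of B] assms obtain k m where "2 \<le> k" "k < int n - 1" "v k True \<in> B"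
    "1 \<le> m" "m < int n" "v m False \<in> B" by auto
  then show ?thesis
    using assms n_ge_3 by (intro card_ge_3I[of B "v 0 True" "v k True" "v m False"]) (auto simp: v_eq)
qed

text \<open>Either both other neighbours of \<open>v 0 True\<close> are blue and make three with it,
  or a white one is separated from the forced vertex, and blocking the two paths costs two blue
  vertices besides \<open>v 0 True\<close>.\<close>

lemma psd_force_card_blue_side:
  assumes F: "psd_force G B (v 0 True) (v 1 True)" and "finite B"
  shows "3 \<le> card B"
proof -
  have ne: "v (-1) True \<noteq> v 1 True" "v 0 False \<noteq> v 1 True"
    using n_ge_3 by (simp_all add: v_eq)
  note B = psd_forceD[OF F]
  consider "v 0 False \<notin> B" | "v (-1) True \<notin> B" | "v 0 False \<in> B" "v (-1) True \<in> B" by blast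
  then show ?thesis
  proof cases
    case 1
    then show ?thesis
      using corner_separated_card B \<open>finite B\<close> psd_force_separates(1)[OF F _ ne(2)] by (simp add: adj_iff)
  next
    case 2
    then show ?thesis
      using row_separated_card B \<open>finite B\<close> psd_force_separates(1)[OF F _ ne(1)] by (simp add: adj_iff)
  next
    case 3
    then show ?thesis
      using B \<open>finite B\<close> n_ge_3
      by (intro card_ge_3I[of B "v 0 True" "v 0 False" "v (-1) True"]) (auto simp: v_eq)
  qed
qed

lemma psd_force_card_blue_rung:
  assumes F: "psd_force G B (v 0 True) (v 0 False)" and "finite B"
  shows "3 \<le> card B"
proof -
  interpret reflected: prism G n "\<lambda>i. v (- i)" by (rule prism_reflect)
  have ne: "v (-1) True \<noteq> v 0 False" "v 1 True \<noteq> v 0 False"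
    using n_ge_3 by (simp_all add: v_eq)
  note B = psd_forceD[OF F]
  consider "v 1 True \<notin> B" | "v (-1) True \<notin> B" | "v 1 True \<in> B" "v (-1) True \<in> B" by blast
  then show ?thesis
  proof cases
    case 1
    then show ?thesis
      using corner_separated_card B \<open>finite B\<close> psd_force_separates(2)[OF F _ ne(2)] by (simp add: adj_iff)
  next
    case 2
    then show ?thesis
      using reflected.corner_separated_card B \<open>finite B\<close> psd_force_separates(2)[OF F _ ne(1)]
      by (simp add: adj_iff)
  next
    case 3
    then show ?thesis
      using B \<open>finite B\<close> n_ge_3
      by (intro card_ge_3I[of B "v 0 True" "v 1 True" "v (-1) True"]) (auto simp: v_eq)
  qed
qed

text \<open>Moves an arbitrary forcing vertex to \<open>v 0 True\<close>; the unsimplified form of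
  \<open>x\<close> matches the shifted coordinates literally.\<close>

lemma vertex_cases:
  assumes "x \<in> verts G"
  obtains m a where "prism G n (\<lambda>i b. v (m + i) (b = a))" "x = v (m + 0) (True = a)"
  using assms prism_shift unfolding verts_eq by auto

lemma psd_force_card_blue:
  assumes F: "psd_force G B u w" and "finite B"
  shows "3 \<le> card B"
proof -
  have "u \<in> verts G" using psd_forceD[OF F] adj_in_verts by blast
  then obtain m a where m: "prism G n (\<lambda>i b. v (m + i) (b = a))" and u: "u = v (m + 0) (True = a)"
    by (rule vertex_cases)
  define c where "c = (\<lambda>i b. v (m + i) (b = a))"
  interpret c: prism G n c using m unfolding c_def .
  \<comment> \<open>The reflection turns a force onto \<open>c (-1) True\<close> into one onto
    \<open>c 1 True\<close>.\<close>
  interpret reflected: prism G n "\<lambda>i. c (- i)" by (rule c.prism_reflect)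
  have "u = c 0 True" using u by (simp add: c_def)
  moreover have "w = c 1 True \<or> w = c (-1) True \<or> w = c 0 False"
    using psd_forceD(3)[OF F] calculation by (auto simp: c.adj_iff)
  ultimately show ?thesis
    using F \<open>finite B\<close> c.psd_force_card_blue_side reflected.psd_force_card_blue_side
      c.psd_force_card_blue_rung by auto
qed

section \<open>At most three blue vertices stay in a closed neighbourhood\<close>

definition closed_nbhd :: "'a \<Rightarrow> 'a set" where
  "closed_nbhd x = insert x {y. x \<rightarrow>\<^bsub>G\<^esub> y}"

lemma closed_nbhd_eq: "closed_nbhd (v i b) = {v i b, v (i + 1) b, v (i - 1) b, v i (\<not> b)}"
  by (auto simp: closed_nbhd_def adj_iff)

text \<open>Only two configurations survive. Either the two other neighbours of
  \<open>v 0 True\<close> are blue, and its closed neighbourhood is the required one; or both are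
  white, and the blocking conditions make \<open>B\<close> the three neighbours of the forced vertex
  \<open>v 1 True\<close>. With exactly one of them white, blocking would need a fourth blue
  vertex.\<close>

lemma psd_force_side_closed_nbhd:
  assumes F: "psd_force G B (v 0 True) (v 1 True)" and n: "4 \<le> n" and fin: "finite B" "card B \<le> 3"
  shows "\<exists>i b. insert (v 1 True) B \<subseteq> closed_nbhd (v i b)"
proof -
  have ne: "v (-1) True \<noteq> v 1 True" "v 0 False \<noteq> v 1 True"
    using n by (simp_all add: v_eq)
  note B = psd_forceD[OF F]
  have row: "\<exists>k. 2 \<le> k \<and> k < int n - 1 \<and> v k True \<in> B" "\<exists>k. 1 \<le> k \<and> k < int n \<and> v k False \<in> B"
    if "v (-1) True \<notin> B"
    using row_separated[of B] that B psd_force_separates(1)[OF F _ ne(1)] by (simp_all add: adj_iff)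
  show ?thesis
  proof (cases "v 0 False \<in> B")
    case True
    have "v (-1) True \<in> B"
    proof (rule ccontr)
      assume "v (-1) True \<notin> B"
      from row[OF this] obtain k m where km: "2 \<le> k" "k < int n - 1" "v k True \<in> B"
        "1 \<le> m" "m < int n" "v m False \<in> B" by auto
      have "B = {v 0 True, v 0 False, v k True}"
        using B True km n fin by (intro eq_triple_if_card_le_3) (auto simp: v_eq)
      then show False
        using km n by (auto simp: v_eq)
    qed
    then have "B = {v 0 True, v 0 False, v (-1) True}"
      using B True n fin by (intro eq_triple_if_card_le_3) (auto simp: v_eq)
    then show ?thesis
      by (intro exI[of _ 0] exI[of _ True]) (auto simp: closed_nbhd_eq)
  next
    case False
    then have "v 1 False \<in> B"
      using corner_separated(1)[of B] B psd_force_separates(1)[OF F _ ne(2)] by (simp add: adj_iff)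
    have opp: "v 2 True \<in> B \<or> (\<exists>k. 2 \<le> k \<and> k < int n \<and> v k False \<in> B)"
      using False corner_separated(2)[of B] B psd_force_separates(1)[OF F _ ne(2)] by (simp add: adj_iff)
    have "v (-1) True \<notin> B"
    proof
      assume "v (-1) True \<in> B"
      then have "B = {v 0 True, v 1 False, v (-1) True}"
        using B \<open>v 1 False \<in> B\<close> n fin by (intro eq_triple_if_card_le_3) (auto simp: v_eq)
      \<comment> \<open>None of the three vertices blocks the long path: for \<open>n >= 4\<close>,
        columns 2 and -1 are different.\<close>
      then show False
        using opp n by (auto simp: v_eq)
    qed
    from row(1)[OF this] obtain k where k: "2 \<le> k" "k < int n - 1" "v k True \<in> B" by auto
    have "B = {v 0 True, v 1 False, v k True}"
      using B \<open>v 1 False \<in> B\<close> k n fin by (intro eq_triple_if_card_le_3) (auto simp: v_eq)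
    then have "B = {v 0 True, v 1 False, v 2 True}"
      using opp k n by (auto simp: v_eq)
    then show ?thesis
      by (intro exI[of _ 1] exI[of _ True]) (auto simp: closed_nbhd_eq)
  qed
qed

lemma corner_separated_reflect:
  assumes "v 0 False \<notin> B" "v (-1) True \<notin> B"
    and "\<not> v (-1) True \<rightarrow>\<^sup>*\<^bsub>G \<restriction> (verts G - B)\<^esub> v 0 False"
  shows "v (-1) False \<in> B"
proof -
  interpret reflected: prism G n "\<lambda>i. v (- i)" by (rule prism_reflect)
  show ?thesis using reflected.corner_separated(1)[of B] assms by simp
qed

text \<open>When \<open>v 1 True\<close> is white, so is \<open>v (-1) True\<close>, since otherwise
  the long path stays open. The two short paths are then blocked by \<open>v 1 False\<close> and
  \<open>v (-1) False\<close>, so \<open>B\<close> consists of the three neighbours of the forced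
  vertex.\<close>

lemma psd_force_rung_closed_nbhd_aux:
  assumes F: "psd_force G B (v 0 True) (v 0 False)" and n: "4 \<le> n" and fin: "finite B" "card B \<le> 3"
    and right: "v 1 True \<notin> B"
  shows "insert (v 0 False) B \<subseteq> closed_nbhd (v 0 False)"
proof -
  have ne: "v (-1) True \<noteq> v 0 False" "v 1 True \<noteq> v 0 False"
    using n by (simp_all add: v_eq)
  note B = psd_forceD[OF F]
  have "v 1 False \<in> B"
    using corner_separated(1)[of B] B right psd_force_separates(2)[OF F _ ne(2)] by (simp add: adj_iff)
  have opp: "v 2 True \<in> B \<or> (\<exists>k. 2 \<le> k \<and> k < int n \<and> v k False \<in> B)"
    using corner_separated(2)[of B] B right psd_force_separates(2)[OF F _ ne(2)] by (simp add: adj_iff)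
  have "v (-1) True \<notin> B"
  proof
    assume "v (-1) True \<in> B"
    then have "B = {v 0 True, v 1 False, v (-1) True}"
      using B \<open>v 1 False \<in> B\<close> n fin by (intro eq_triple_if_card_le_3) (auto simp: v_eq)
    then show False
      using opp n by (auto simp: v_eq)
  qed
  then have "v (-1) False \<in> B"
    using corner_separated_reflect B psd_force_separates(2)[OF F _ ne(1)] by (simp add: adj_iff)
  then have "B = {v 0 True, v 1 False, v (-1) False}"
    using B \<open>v 1 False \<in> B\<close> n fin by (intro eq_triple_if_card_le_3) (auto simp: v_eq)
  then show ?thesis
    by (auto simp: closed_nbhd_eq)
qed

lemma psd_force_rung_closed_nbhd:
  assumes F: "psd_force G B (v 0 True) (v 0 False)" and n: "4 \<le> n" and fin: "finite B" "card B \<le> 3"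
  shows "\<exists>i b. insert (v 0 False) B \<subseteq> closed_nbhd (v i b)"
proof -
  interpret reflected: prism G n "\<lambda>i. v (- i)" by (rule prism_reflect)
  consider "v 1 True \<notin> B" | "v (-1) True \<notin> B" | "v 1 True \<in> B" "v (-1) True \<in> B" by blast
  then show ?thesis
  proof cases
    case 1
    then show ?thesis using psd_force_rung_closed_nbhd_aux assms by blast
  next
    case 2
    then show ?thesis using reflected.psd_force_rung_closed_nbhd_aux[of B] assms by auto
  next
    case 3
    then have "B = {v 0 True, v 1 True, v (-1) True}"
      using psd_forceD[OF F] n fin by (intro eq_triple_if_card_le_3) (auto simp: v_eq)
    then show ?thesis
      by (intro exI[of _ 0] exI[of _ True]) (auto simp: closed_nbhd_eq)
  qed
qed

text \<open>The centre has no white neighbour. Any other member has two white neighbours, and these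
  remain connected outside the closed neighbourhood: around the square on the far side of a
  horizontal edge, or along the row opposite the centre.\<close>

lemma closed_nbhd_no_force_base:
  assumes n: "4 \<le> n" and x: "v 0 True \<in> closed_nbhd x"
  shows "\<not> psd_force G (closed_nbhd x) (v 0 True) w"
proof
  assume F: "psd_force G (closed_nbhd x) (v 0 True) w"
  interpret reflected: prism G n "\<lambda>i. v (- i)" by (rule prism_reflect)
  note B = psd_forceD[OF F]
  have sep: "\<not> y \<rightarrow>\<^sup>*\<^bsub>G \<restriction> (verts G - closed_nbhd x)\<^esub> z"
    if "w = y \<or> w = z" "y \<noteq> z" "v 0 True \<rightarrow>\<^bsub>G\<^esub> y" "v 0 True \<rightarrow>\<^bsub>G\<^esub> z" for y z
    using that psd_force_separates[OF F] by blast
  have w: "w = v 1 True \<or> w = v (-1) True \<or> w = v 0 False"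
    using B(3) by (simp add: adj_iff)
  have "x = v 0 True \<or> x = v 1 True \<or> x = v (-1) True \<or> x = v 0 False"
    using x sym_arcs by (auto simp: closed_nbhd_def adj_iff symmetric_def dest!: symD)
  then show False
  proof (elim disjE)
    assume "x = v 0 True"
    then show False using B(2,3) by (simp add: closed_nbhd_def)
  next
    assume x: "x = v 1 True"
    show False
      using corner_separated_reflect[of "closed_nbhd x"] sep[of "v (-1) True" "v 0 False"] n w B(2)
      by (auto simp: x closed_nbhd_eq v_eq adj_iff)
  next
    assume x: "x = v (-1) True"
    show False
      using corner_separated(1)[of "closed_nbhd x"] sep[of "v 1 True" "v 0 False"] n w B(2)
      by (auto simp: x closed_nbhd_eq v_eq adj_iff)
  next
    assume x: "x = v 0 False"
    show False
      using row_separated(1)[of "closed_nbhd x"] sep[of "v 1 True" "v (-1) True"] n w B(2)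
      by (auto simp: x closed_nbhd_eq v_eq adj_iff)
  qed
qed

text \<open>The disjunction \<open>inv\<close> is the invariant behind the bound of four: a full
  closed neighbourhood admits no force, so a force occurs only with at most three blue vertices, and
  the result again fits into some closed neighbourhood.\<close>

lemma psd_force_closed_nbhd:
  assumes F: "psd_force G B u w" and n: "4 \<le> n" and B: "finite B"
    and inv: "card B \<le> 3 \<or> (\<exists>x\<in>verts G. B = closed_nbhd x)"
  shows "\<exists>x\<in>verts G. insert w B \<subseteq> closed_nbhd x"
proof -
  have "u \<in> verts G" using psd_forceD[OF F] adj_in_verts by blast
  then obtain m a where m: "prism G n (\<lambda>i b. v (m + i) (b = a))" and u: "u = v (m + 0) (True = a)"
    by (rule vertex_cases)
  define c where "c = (\<lambda>i b. v (m + i) (b = a))"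
  interpret c: prism G n c using m unfolding c_def .
  interpret reflected: prism G n "\<lambda>i. c (- i)" by (rule c.prism_reflect)
  have u: "u = c 0 True" using u by (simp add: c_def)
  have card: "card B \<le> 3"
    using inv c.closed_nbhd_no_force_base[OF n] psd_forceD(1)[OF F] F u by blast
  have "w = c 1 True \<or> w = c (-1) True \<or> w = c 0 False"
    using psd_forceD(3)[OF F] u by (auto simp: c.adj_iff)
  then show ?thesis
  proof (elim disjE)
    assume "w = c 1 True"
    then show ?thesis
      using c.psd_force_side_closed_nbhd[of B] F u n B card c.v_in_verts by metis
  next
    assume "w = c (-1) True"
    then show ?thesis
      using reflected.psd_force_side_closed_nbhd[of B] F u n B card c.v_in_verts
      by (metis minus_zero)
  next
    assume "w = c 0 False"
    then show ?thesis
      using c.psd_force_rung_closed_nbhd[of B] F u n B card c.v_in_verts by metis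
  qed
qed

lemma card_closed_nbhd_le: "x \<in> verts G \<Longrightarrow> card (closed_nbhd x) \<le> 4"
proof -
  assume "x \<in> verts G"
  then obtain i b where "x = v i b" by (auto simp: verts_eq)
  then show ?thesis
    using card_length[of "[v i b, v (i + 1) b, v (i - 1) b, v i (\<not> b)]"]
    by (simp add: closed_nbhd_eq)
qed

lemma card_verts: "card (verts G) = 2 * n"
proof -
  have "v i b = v (i mod int n) b" for i b
    by (simp add: v_eq_iff mod_eq_dvd_iff[symmetric])
  then have "verts G = (\<lambda>(i, b). v i b) ` ({0..<int n} \<times> UNIV)"
    unfolding verts_eq using n_ge_3 by (auto intro!: image_eqI[of _ _ "(_ mod int n, _)"])
  moreover have "inj_on (\<lambda>(i, b). v i b) ({0..<int n} \<times> UNIV)"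
    by (auto simp: inj_on_def v_eq)
  ultimately show ?thesis
    by (simp add: card_image card_cartesian_product)
qed

text \<open>Having at most two blue vertices is an invariant because no force is possible from such
  a set.\<close>

lemma card_leaky_psd_forcing_set_ge_3:
  assumes B: "leaky_psd_forcing_set G l B" and l: "l \<le> 2 * n"
  shows "3 \<le> card B"
proof (rule ccontr)
  assume "\<not> 3 \<le> card B"
  then have "card (verts G) \<le> 2"
    using B l by (intro leaky_psd_forcing_set_invariant[OF B, where P = "\<lambda>C. card C \<le> 2"])
      (auto simp: card_verts dest!: psd_force_card_blue intro: finite_subset)
  then show False using n_ge_3 by (simp add: card_verts)
qed

lemma card_leaky_psd_forcing_set_ge_4:
  assumes n: "4 \<le> n" and B: "leaky_psd_forcing_set G l B" and l: "l \<le> 2 * n"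
  shows "4 \<le> card B"
proof (rule ccontr)
  let ?P = "\<lambda>C. card C \<le> 3 \<or> (\<exists>x\<in>verts G. C = closed_nbhd x)"
  assume "\<not> 4 \<le> card B"
  have "?P (verts G)"
  proof (rule leaky_psd_forcing_set_invariant[OF B, where P = ?P])
    show "l \<le> card (verts G)" using l by (simp add: card_verts)
    show "?P B" using \<open>\<not> 4 \<le> card B\<close> by simp
    fix C u w assume C: "C \<subseteq> verts G" "?P C" "psd_force G C u w"
    have "finite C" using C(1) finite_verts by (rule finite_subset)
    from psd_force_closed_nbhd[OF C(3) n this C(2)]
    obtain x where x: "x \<in> verts G" "insert w C \<subseteq> closed_nbhd x" by blast
    have "finite (closed_nbhd x)"
      using x(1) by (auto simp: verts_eq closed_nbhd_eq)
    \<comment> \<open>A closed neighbourhood has at most four vertices, so a subset with at least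
      four is all of it.\<close>
    then have "insert w C = closed_nbhd x" if "4 \<le> card (insert w C)"
      using card_seteq[OF _ x(2)] that card_closed_nbhd_le[OF x(1)] by linarith
    then show "?P (insert w C)"
      using x(1) by (cases "4 \<le> card (insert w C)") auto
  qed
  then have "card (verts G) \<le> 4"
    using card_closed_nbhd_le by auto
  then show False using n by (simp add: card_verts)
qed

section \<open>Blue sets that force the prism despite leaks\<close>

lemma psd_force_white_neighbour:
  assumes "u \<in> C" "u \<rightarrow>\<^bsub>G\<^esub> w" "w \<notin> C" "\<And>x. u \<rightarrow>\<^bsub>G\<^esub> x \<Longrightarrow> x \<notin> C \<Longrightarrow> x = w"
  shows "psd_force G C u w"
proof (rule psd_forceI[where W = "- C"])
  show "x = w" if "x \<in> - C" "u \<rightarrow>\<^bsub>G\<^esub> x" for x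
    using that(1) by (intro assms(4) that(2)) simp
qed (simp_all add: assms(1-3))

lemma verts_psubsetE:
  assumes "C \<subset> verts G"
  obtains i b where "0 \<le> i" "i < int n" "v i b \<notin> C"
proof -
  obtain i b where "v i b \<notin> C" using assms by (auto simp: verts_eq)
  moreover have "v (i mod int n) b = v i b"
    by (simp add: v_eq_iff mod_eq_dvd_iff[symmetric])
  ultimately show ?thesis
    using that[of "i mod int n" b] n_ge_3 by auto
qed

text \<open>The white region can be attacked from both sides. Next to the first and the last column
  containing a white vertex there are two full blue columns, so the vertex beside such a white
  vertex has no other white neighbour.\<close>

lemma leaky_psd_forcing_set_two_columns:
  "leaky_psd_forcing_set G 1 {v 0 True, v 0 False, v 1 True, v 1 False}"
proof (rule leaky_psd_forcing_setI)
  fix L C assume L: "L \<subseteq> verts G" "card L = 1"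
    and C: "{v 0 True, v 0 False, v 1 True, v 1 False} \<subseteq> C" "C \<subset> verts G"
  define S where "S = {i \<in> {0..<int n}. \<exists>b. v i b \<notin> C}"
  obtain k d where "0 \<le> k" "k < int n" "v k d \<notin> C"
    using verts_psubsetE[OF C(2)] .
  then have "S \<noteq> {}"
    by (auto simp: S_def)
  moreover have "finite S"
    by (rule finite_subset[of _ "{0..<int n}"]) (auto simp: S_def)
  ultimately have S: "finite S" "S \<noteq> {}" by simp_all
  have cols: "v 0 b \<in> C" "v 1 b \<in> C" for b
    using C(1) by (cases b; simp)+
  have wrap: "v (int n) b \<in> C" "v (int n + 1) b \<in> C" for b
    using cols v_periodic[of 0] v_periodic[of 1] by simp_all
  obtain i j where i: "i \<in> S" "\<And>k. k \<in> S \<Longrightarrow> i \<le> k" and j: "j \<in> S" "\<And>k. k \<in> S \<Longrightarrow> k \<le> j"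
    using that[of "Min S" "Max S"] S by simp
  have S_cases: "\<exists>b. v k b \<notin> C" "0 \<le> k" "k < int n" if "k \<in> S" for k
    using that by (auto simp: S_def)
  have "i \<noteq> 0" "i \<noteq> 1"
    using S_cases(1)[OF i(1)] cols by blast+
  then have bounds: "2 \<le> i" "i \<le> j" "j < int n"
    using S_cases[OF i(1)] S_cases[OF j(1)] j(2)[OF i(1)] by auto
  have left: "v k b \<in> C" if "0 \<le> k" "k < i" for k b
  proof -
    have "k \<notin> S" using i(2)[of k] that by auto
    then show ?thesis using that bounds by (auto simp: S_def)
  qed
  \<comment> \<open>The range reaches \<open>int n + 1\<close>, because the forcer in column
    \<open>j + 1\<close> has a neighbour in column \<open>j + 2\<close>, which may be column 1 after
    wrapping around.\<close>
  have right: "v k b \<in> C" if "j < k" "k \<le> int n + 1" for k b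
  proof -
    have "k < int n \<or> k = int n \<or> k = int n + 1" using that by auto
    moreover have "k \<notin> S" using j(2)[of k] that by auto
    ultimately show ?thesis
      using that bounds wrap by (auto simp: S_def)
  qed
  obtain b c where bc: "v i b \<notin> C" "v j c \<notin> C"
    using S_cases(1)[OF i(1)] S_cases(1)[OF j(1)] by blast
  have "psd_force G C (v (i - 1) b) (v i b)"
  proof (rule psd_force_white_neighbour)
    show "x = v i b" if "v (i - 1) b \<rightarrow>\<^bsub>G\<^esub> x" "x \<notin> C" for x
      using that left[of "i - 1"] left[of "i - 1 - 1"] bounds by (auto simp: adj_iff)
  qed (use bc left bounds in \<open>simp_all add: adj_iff\<close>)
  moreover have "psd_force G C (v (j + 1) c) (v j c)"
  proof (rule psd_force_white_neighbour)
    show "x = v j c" if "v (j + 1) c \<rightarrow>\<^bsub>G\<^esub> x" "x \<notin> C" for x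
      using that right[of "j + 1"] right[of "j + 1 + 1"] bounds by (auto simp: adj_iff)
  qed (use bc right bounds in \<open>simp_all add: adj_iff\<close>)
  \<comment> \<open>The columns \<open>i - 1\<close> and \<open>j + 1\<close> differ by at least 2
    and at most \<open>n - 1\<close>, hence are distinct modulo \<open>n\<close>.\<close>
  moreover have "v (i - 1) b \<noteq> v (j + 1) c"
    using bounds by (simp add: v_eq)
  ultimately show "\<exists>u w. u \<notin> L \<and> psd_force G C u w"
    by (rule exists_force_two_forcers[OF L(2)])
next
  show "{v 0 True, v 0 False, v 1 True, v 1 False} \<subseteq> verts G"
    by (intro insert_subsetI v_in_verts empty_subsetI)
qed

lemma leaky_psd_forcing_set_row: "leaky_psd_forcing_set G 1 (range (\<lambda>i. v i True))"
proof (rule leaky_psd_forcing_setI)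
  fix L C assume L: "L \<subseteq> verts G" "card L = 1"
    and C: "range (\<lambda>i. v i True) \<subseteq> C" "C \<subset> verts G"
  have row: "v i True \<in> C" for i using C(1) by auto
  obtain i b where "v i b \<notin> C" using C(2) by (auto simp: verts_eq)
  then have i: "v i False \<notin> C" using row by (cases b) auto
  have vertical: "psd_force G C (v k True) (v k False)" if "v k False \<notin> C" for k
    using row that by (intro psd_force_white_neighbour) (auto simp: adj_iff)
  \<comment> \<open>A second forcer: another rung with a white end if one of the next two columns
    has one, and otherwise the blue vertex beside \<open>v i False\<close> in its own row.\<close>
  consider "v (i + 1) False \<notin> C" | "v (2 + i) False \<notin> C"
    | "v (i + 1) False \<in> C" "v (2 + i) False \<in> C" by blast
  then obtain u w where uw: "u \<noteq> v i True" "psd_force G C u w"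
  proof cases
    case 1
    then show ?thesis using that[OF _ vertical[of "i + 1"]] n_ge_3 by (simp add: v_eq)
  next
    case 2
    then show ?thesis using that[OF _ vertical[of "2 + i"]] n_ge_3 by (simp add: v_eq)
  next
    case 3
    then have "psd_force G C (v (i + 1) False) (v i False)"
      using row i by (intro psd_force_white_neighbour) (auto simp: adj_iff)
    then show ?thesis by (intro that[of "v (i + 1) False"]) simp_all
  qed
  show "\<exists>u w. u \<notin> L \<and> psd_force G C u w"
    by (rule exists_force_two_forcers[OF L(2) vertical[OF i] uw(2) uw(1)[symmetric]])
qed (simp add: image_subset_iff)

lemma degree: "card {y. v i b \<rightarrow>\<^bsub>G\<^esub> y} = 3"
proof -
  have "{y. v i b \<rightarrow>\<^bsub>G\<^esub> y} = {v (i + 1) b, v (i - 1) b, v i (\<not> b)}"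
    by (auto simp: adj_iff)
  then show ?thesis using n_ge_3 by (simp add: v_eq)
qed

lemma triangle_free:
  assumes "4 \<le> n" "x \<rightarrow>\<^bsub>G\<^esub> y" "y \<rightarrow>\<^bsub>G\<^esub> z"
  shows "\<not> z \<rightarrow>\<^bsub>G\<^esub> x"
proof -
  obtain i b where x: "x = v i b"
    using adj_in_verts(1)[OF assms(2)] by (auto simp: verts_eq)
  show ?thesis
    using assms(1) assms(2,3)[unfolded x] unfolding x by (auto simp: adj_iff v_eq)
qed

text \<open>In a gap of at most two columns every white vertex has a neighbour in the adjacent blue
  column that sees nothing else in the gap and can force it. If no non-leak can force, all these
  outer neighbours leak, so at most two white vertices remain and the small-component argument
  applies.\<close>

lemma exists_force_in_gap:
  assumes n: "4 \<le> n" and pq: "p \<le> q" "q \<le> p + 1"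
    and ends: "\<And>b. v (p - 1) b \<in> C" "\<And>b. v (q + 1) b \<in> C"
    and white: "p \<le> i" "i \<le> q" "v i b \<notin> C"
    and L: "finite L" "card L \<le> 2"
  shows "\<exists>u w. u \<notin> L \<and> psd_force G C u w"
proof (rule ccontr)
  assume stuck: "\<not> ?thesis"
  \<comment> \<open>Positions rather than vertices are collected, so that the outer neighbour can be
    chosen by column.\<close>
  define I where "I = {(i, b). p \<le> i \<and> i \<le> q \<and> v i b \<notin> C}"
  define W where "W = (\<lambda>(i, b). v i b) ` I"
  have memW: "v j c \<in> W" if "p \<le> j" "j \<le> q" "v j c \<notin> C" for j c
    using that unfolding W_def I_def by force
  have closed: "y \<in> W" if x: "x \<in> W" "x \<rightarrow>\<^bsub>G\<^esub> y" "y \<notin> C" for x y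
  proof -
    obtain j c where j: "x = v j c" "p \<le> j" "j \<le> q"
      using x(1) by (auto simp: W_def I_def)
    then have "y = v (j + 1) c \<or> y = v (j - 1) c \<or> y = v j (\<not> c)"
      using x(2) by (simp add: adj_iff)
    moreover have "j + 1 \<le> q \<or> j + 1 = q + 1" "p \<le> j - 1 \<or> j - 1 = p - 1" using j by auto
    ultimately show ?thesis using x(3) ends j memW by (elim disjE) auto
  qed
  define out where "out = (\<lambda>(i, b). v (if i = p then p - 1 else q + 1) b)"
  have "out ` I \<subseteq> L"
  proof clarify
    fix j c assume "(j, c) \<in> I"
    then have j: "p \<le> j" "j \<le> q" "v j c \<notin> C" by (auto simp: I_def)
    then have "j = p \<or> j \<noteq> p \<and> j = q" using pq by auto
    have "psd_force G C (out (j, c)) (v j c)"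
    proof (rule psd_forceI[where W = W])
      show "out (j, c) \<in> C" using ends by (auto simp: out_def)
      show "out (j, c) \<rightarrow>\<^bsub>G\<^esub> v j c" using \<open>j = p \<or> _\<close> by (auto simp: out_def adj_iff)
      show "v j c \<in> W" "v j c \<notin> C" using j memW by auto
      fix x assume "x \<in> W" "out (j, c) \<rightarrow>\<^bsub>G\<^esub> x"
      moreover obtain k d where k: "x = v k d" "p \<le> k" "k \<le> q" using \<open>x \<in> W\<close> by (auto simp: W_def I_def)
      ultimately show "x = v j c"
        using j pq n by (auto simp: out_def adj_iff v_eq split: if_splits)
    qed (rule closed)
    then show "out (j, c) \<in> L" using stuck by blast
  qed
  \<comment> \<open>The columns \<open>p - 1\<close> and \<open>q + 1\<close> differ by at most 3,
    so they are distinct for \<open>n >= 4\<close>.\<close>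
  moreover have "inj_on out I"
    using n pq by (auto simp: inj_on_def out_def I_def v_eq split: if_splits)
  ultimately have "card I \<le> 2"
    using card_inj_on_le[of out I L] L by auto
  have "finite I"
    by (rule finite_subset[of _ "{p..q} \<times> UNIV"]) (auto simp: I_def)
  then have "card W \<le> 2"
    using \<open>card I \<le> 2\<close> card_image_le[of I] unfolding W_def by (meson order_trans)
  have "\<exists>u w. u \<notin> L \<and> psd_force G C u w"
  proof (rule exists_force_small_component[of W C L])
    show "W \<subseteq> verts G" "W \<inter> C = {}" by (auto simp: W_def I_def)
    show "W \<noteq> {}" using memW[OF white] by blast
    show "3 \<le> card {y. x \<rightarrow>\<^bsub>G\<^esub> y}" if "x \<in> W" for x
      using that by (auto simp: W_def degree)
    show "\<not> z \<rightarrow>\<^bsub>G\<^esub> x" if "x \<rightarrow>\<^bsub>G\<^esub> y" "y \<rightarrow>\<^bsub>G\<^esub> z" for x y z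
      using triangle_free[OF n that] .
  qed (use closed L \<open>card W \<le> 2\<close> in simp_all)
  with stuck show False by blast
qed

text \<open>The gaps are columns 1 to 2 and columns 4 to \<open>n - 1\<close>. The second is empty
  for \<open>n = 4\<close> and has width \<open>n - 4\<close>, which is at most two exactly up to
  \<open>n = 6\<close>.\<close>

lemma leaky_psd_forcing_set_opposite_columns:
  assumes n: "n \<in> {4, 5, 6}"
  shows "leaky_psd_forcing_set G 2 {v 0 True, v 0 False, v 3 True, v 3 False}"
proof (rule leaky_psd_forcing_setI)
  fix L C assume L: "L \<subseteq> verts G" "card L = 2"
    and C: "{v 0 True, v 0 False, v 3 True, v 3 False} \<subseteq> C" "C \<subset> verts G"
  have L': "finite L" "card L \<le> 2" using L finite_subset[OF L(1)] by auto
  have cols: "v 0 b \<in> C" "v 3 b \<in> C" for b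
    using C(1) by (cases b; simp)+
  then have wrap: "v (int n) b \<in> C" for b
    using v_periodic[of 0] by simp
  obtain i b where i: "0 \<le> i" "i < int n" "v i b \<notin> C"
    using verts_psubsetE[OF C(2)] .
  then have "i \<noteq> 0" "i \<noteq> 3" using cols by auto
  with i have "1 \<le> i \<and> i \<le> 2 \<or> 4 \<le> i \<and> i \<le> int n - 1" by auto
  then show "\<exists>u w. u \<notin> L \<and> psd_force G C u w"
  proof
    assume "1 \<le> i \<and> i \<le> 2"
    then show ?thesis
      using n i cols L' by (intro exists_force_in_gap[of 1 2 C i b]) auto
  next
    assume "4 \<le> i \<and> i \<le> int n - 1"
    then show ?thesis
      using n i cols wrap L' by (intro exists_force_in_gap[of 4 "int n - 1" C i b]) auto
  qed
qed simp

section \<open>Values of the forcing number\<close>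

lemma leaky_psd_forcing_number_three_leaks:
  assumes "3 \<le> l" "l \<le> 2 * n"
  shows "leaky_psd_forcing_number G l = 2 * n"
proof (rule leaky_psd_forcing_number_eqI)
  show "leaky_psd_forcing_set G l (verts G)" by (rule leaky_psd_forcing_set_verts)
  show "card (verts G) = 2 * n" by (rule card_verts)
  fix B assume "leaky_psd_forcing_set G l B"
  then have "B = verts G"
  proof (rule leaky_psd_forcing_set_eq_verts)
    show "l \<le> card (verts G)" using assms by (simp add: card_verts)
    fix x assume "x \<in> verts G"
    moreover have "{u. u \<rightarrow>\<^bsub>G\<^esub> x} = {u. x \<rightarrow>\<^bsub>G\<^esub> u}" using adj_sym by blast
    ultimately show "card {u. u \<rightarrow>\<^bsub>G\<^esub> x} \<le> l"
      using assms by (auto simp: verts_eq degree)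
  qed
  then show "2 * n \<le> card B" by (simp add: card_verts)
qed

lemma leaky_psd_forcing_number_triangular:
  assumes "l \<le> 1" "n = 3"
  shows "leaky_psd_forcing_number G l = 3"
proof (rule leaky_psd_forcing_number_eqI)
  show "leaky_psd_forcing_set G l (range (\<lambda>i. v i True))"
    using leaky_psd_forcing_set_antimono[OF _ leaky_psd_forcing_set_row] assms by (simp add: card_verts)
  have "v i True = v (i mod int n) True" for i
    by (simp add: v_eq_iff mod_eq_dvd_iff[symmetric])
  then have "range (\<lambda>i. v i True) = (\<lambda>i. v i True) ` {0..<int n}"
    using n_ge_3 by (auto intro!: image_eqI[of _ _ "_ mod int n"])
  moreover have "inj_on (\<lambda>i. v i True) {0..<int n}"
    by (auto simp: inj_on_def v_eq)
  ultimately show "card (range (\<lambda>i. v i True)) = 3"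
    using assms by (simp add: card_image)
  show "3 \<le> card C" if "leaky_psd_forcing_set G l C" for C
    using card_leaky_psd_forcing_set_ge_3[OF that] assms by simp
qed

lemma leaky_psd_forcing_number_at_most_one_leak:
  assumes "l \<le> 1" "4 \<le> n"
  shows "leaky_psd_forcing_number G l = 4"
proof (rule leaky_psd_forcing_number_eqI)
  show "leaky_psd_forcing_set G l {v 0 True, v 0 False, v 1 True, v 1 False}"
    using leaky_psd_forcing_set_antimono[OF _ leaky_psd_forcing_set_two_columns] assms
    by (simp add: card_verts)
  show "card {v 0 True, v 0 False, v 1 True, v 1 False} = 4"
    using assms by (simp add: v_eq)
  show "4 \<le> card C" if "leaky_psd_forcing_set G l C" for C
    using card_leaky_psd_forcing_set_ge_4[OF assms(2) that] assms by simp
qed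

lemma leaky_psd_forcing_number_two_leaks:
  assumes "n \<in> {4, 5, 6}"
  shows "leaky_psd_forcing_number G 2 = 4"
proof (rule leaky_psd_forcing_number_eqI)
  show "leaky_psd_forcing_set G 2 {v 0 True, v 0 False, v 3 True, v 3 False}"
    using assms by (rule leaky_psd_forcing_set_opposite_columns)
  show "card {v 0 True, v 0 False, v 3 True, v 3 False} = 4"
    using assms by (auto simp: v_eq)
  show "4 \<le> card C" if "leaky_psd_forcing_set G 2 C" for C
    using card_leaky_psd_forcing_set_ge_4[OF _ that] assms by auto
qed

end

section \<open>The product graph in integer coordinates\<close>

definition prism_vertex :: "nat \<Rightarrow> int \<Rightarrow> bool \<Rightarrow> nat \<times> nat" where
  "prism_vertex n i b = (nat (i mod int n), if b then 1 else 0)"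

lemma adj_prism_graph_iff:
  assumes "3 \<le> n"
  shows "prism_vertex n i b \<rightarrow>\<^bsub>with_proj (prism_graph n)\<^esub> y \<longleftrightarrow>
    y = prism_vertex n (i + 1) b \<or> y = prism_vertex n (i - 1) b \<or> y = prism_vertex n i (\<not> b)"
proof -
  obtain j a where y: "y = (j, a)" by fastforce
  let ?c = "\<lambda>k. nat (k mod int n)"
  have c_less: "?c k < n" for k
    using assms by (simp add: nat_less_iff)
  have c_Suc: "?c (k + 1) = Suc (?c k) mod n" for k
  proof -
    have "(k + 1) mod int n = int (Suc (?c k) mod n)"
      using assms by (simp add: zmod_int mod_simps add.commute)
    then show ?thesis by simp
  qed
  have Suc_mod_inj: "p = q" if "Suc p mod n = Suc q mod n" "p < n" "q < n" for p q
    using that by (auto simp: mod_Suc split: if_splits)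
  have "(prism_vertex n i b, y) \<in> parcs (prism_graph n) \<longleftrightarrow>
      (j = ?c i \<and> a < 2 \<and> a \<noteq> (if b then 1 else 0) \<or>
       a = (if b then 1 else 0) \<and> j < n \<and> (j = Suc (?c i) mod n \<or> ?c i = Suc j mod n))"
    using c_less
    by (auto simp: y prism_graph_def cartesian_product_def cycle_graph_def path_graph_def
        prism_vertex_def split: if_splits)
  \<comment> \<open>The cycle arcs describe the predecessor only through \<open>Suc j mod n\<close>;
    since this map is injective on residues, the predecessor is column \<open>i - 1\<close>.\<close>
  moreover have "j < n \<and> ?c i = Suc j mod n \<longleftrightarrow> j = ?c (i - 1)"
  proof -
    have "?c i = Suc (?c (i - 1)) mod n"
      using c_Suc[of "i - 1"] by simp
    then show ?thesis
      using c_less[of "i - 1"] Suc_mod_inj by metis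
  qed
  ultimately have "(prism_vertex n i b, y) \<in> parcs (prism_graph n) \<longleftrightarrow>
      (j = ?c i \<and> a < 2 \<and> a \<noteq> (if b then 1 else 0) \<or>
       a = (if b then 1 else 0) \<and> (j = ?c (i + 1) \<or> j = ?c (i - 1)))"
    using c_Suc[of i] c_less[of "i + 1"] by metis
  moreover have "a < 2 \<and> a \<noteq> (if b then 1 else 0) \<longleftrightarrow> a = (if \<not> b then 1 else 0)"
    by auto
  ultimately show ?thesis
    unfolding y prism_vertex_def with_proj_simps prod.inject by metis
qed

lemma prism_prism_graph:
  assumes n: "3 \<le> n"
  shows "prism (with_proj (prism_graph n)) n (prism_vertex n)"
proof -
  interpret pair_graph "prism_graph n"
    using n by (intro pair_graph_prism_graph) simp
  show ?thesis
  proof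
    have verts: "verts (with_proj (prism_graph n)) = {..<n} \<times> {..<2}"
      by (simp add: prism_graph_def cartesian_product_def cycle_graph_def path_graph_def)
    show "verts (with_proj (prism_graph n)) = {prism_vertex n i b |i b. True}"
      unfolding verts
    proof (intro equalityI subsetI)
      fix x assume "x \<in> {..<n} \<times> {..<2 :: nat}"
      then obtain i a where "x = (i, a)" "i < n" "a < 2" by auto
      then have "x = prism_vertex n (int i) (a = 1)"
        by (auto simp: prism_vertex_def)
      then show "x \<in> {prism_vertex n i b |i b. True}" by blast
    qed (use n in \<open>auto simp: prism_vertex_def nat_less_iff\<close>)
    show "prism_vertex n i b = prism_vertex n j c \<longleftrightarrow> int n dvd i - j \<and> b = c" for i b j c
      using n by (auto simp: prism_vertex_def eq_nat_nat_iff mod_eq_dvd_iff)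
  qed (use n adj_prism_graph_iff in auto)
qed

theorem theorem29:
  fixes n l :: nat
  assumes "n \<ge> 3" and "l \<le> 2 * n"
  shows "(l \<in> {0, 1} \<and> n = 3 \<longrightarrow> leaky_psd_forcing_number (with_proj (prism_graph n)) l = 3) \<and>
         (l \<in> {0, 1} \<and> n \<ge> 4 \<longrightarrow> leaky_psd_forcing_number (with_proj (prism_graph n)) l = 4) \<and>
         (l = 2 \<and> n \<in> {4, 5, 6} \<longrightarrow> leaky_psd_forcing_number (with_proj (prism_graph n)) l = 4) \<and>
         (l \<ge> 3 \<longrightarrow> leaky_psd_forcing_number (with_proj (prism_graph n)) l = 2 * n)"
proof -
  interpret prism "with_proj (prism_graph n)" n "prism_vertex n"
    using assms(1) by (rule prism_prism_graph)
  show ?thesis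
    using assms leaky_psd_forcing_number_three_leaks leaky_psd_forcing_number_triangular
      leaky_psd_forcing_number_at_most_one_leak leaky_psd_forcing_number_two_leaks
    by auto
qed

end
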